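(* Let $\lambda>0$ and let $\mu\in\mathbb{C}$ satisfy $|1-\mu|<\lambda$. If $f\in\mathcal{U}(\lambda,\mu)$ and $$\frac{z}{f(z)}=1+\sum_{k=1}^{\infty}b_kz^k,$$ then $$\sum_{k=2}^{\infty}|b_k|^2(k-1)^2\le\lambda^2\left(1-\frac{|1-\mu|^2}{\lambda^2}\right).$$ This inequality is best possible: for every such $\lambda,\mu$ there exists $f\in\mathcal{U}(\lambda,\mu)$ for which equality holds.
   Context: $\mathbb{D}=\{z\in\mathbb{C}:|z|<1\}$. For $\lambda>0$ and $\mu\in\mathbb{C}$ with $|1-\mu|<\lambda$, $\mathcal{U}(\lambda,\mu)$ denotes the family of all functions $f$ meromorphic in $\mathbb{D}$, normalized by $f(0)=f'(0)-1=0$, such that $|U_f(z)-\mu|<\lambda$ for all $z\in\mathbb{D}$, where $$U_f(z)=\left(\frac{z}{f(z)}\right)^2 f'(z)=\frac{z}{f(z)}-z\left(\frac{z}{f(z)}\right)',$$ understood with removable singularities removed (at $z=0$, where $z/f(z)$ takes the value $1$, and at the poles of $f$, where $z/f(z)$ takes the value $0$). The expansion of $z/f(z)$ is its Taylor expansion about $0$. *)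

theory Defs
  imports "HOL-Complex_Analysis.Complex_Analysis"
begin

(* A meromorphic function is represented by its value at every regular point and by 0 at every
   pole (nicely_meromorphic_on), so plain quotients such as z / f z may carry junk values at
   isolated points; remove_sings restores the continuous extension there. *)

definition id_quot :: "(complex \<Rightarrow> complex) \<Rightarrow> complex \<Rightarrow> complex" where
  "id_quot f = remove_sings (\<lambda>z. z / f z)"

(* At a zero p \<noteq> 0 of f, where the expression has a genuine pole, remove_sings returns 0 by
   convention. This cannot let f into the class U_class below, because the expression is then
   unbounded near p. *)
definition U_op :: "(complex \<Rightarrow> complex) \<Rightarrow> complex \<Rightarrow> complex" where
  "U_op f = remove_sings (\<lambda>z. (z / f z)\<^sup>2 * deriv f z)"

(* The condition analytic_on {0} excludes a pole at 0, where the representing value is also 0. *)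
definition U_class :: "real \<Rightarrow> complex \<Rightarrow> (complex \<Rightarrow> complex) set" where
  "U_class lam mu =
     {f. f nicely_meromorphic_on ball 0 1 \<and> f analytic_on {0} \<and> f 0 = 0 \<and> deriv f 0 = 1 \<and>
         (\<forall>z\<in>ball 0 1. cmod (U_op f z - mu) < lam)}"

(* id_quot f z = 1 + (b 1) z + (b 2) z^2 + ... near 0; the value b 0 is not used. *)
definition id_quot_expansion :: "(complex \<Rightarrow> complex) \<Rightarrow> (nat \<Rightarrow> complex) \<Rightarrow> bool" where
  "id_quot_expansion f b \<longleftrightarrow>
     (\<forall>\<^sub>F z in nhds 0. (\<lambda>k. b (Suc k) * z ^ Suc k) sums (id_quot f z - 1))"

end

(* U_f = z/f - z (z/f)' has Taylor coefficients (1 - k) b_k, so the inequality is Gutzmer's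
   inequality (sum of |c_k|^2 <= M^2 for a function bounded by M on the disc) for U_f - mu, whose
   constant term 1 - mu accounts for the subtracted quantity. Gutzmer's inequality comes from
   Parseval's identity over the N-th roots of unity for the Taylor polynomials of degree < N.
   Equality needs U_f - mu to be lam times an inner function with value a = (1 - mu)/lam and
   vanishing derivative at 0: take lam (z^2 + a)/(1 + cnj a z^2) and solve for b_k. *)

theory Submission
  imports Defs
begin

section \<open>Gutzmer's inequality by discrete Fourier orthogonality\<close>

text \<open>The summands are powers of \<open>x = cis (2 * pi * (k - l) / N)\<close>, an N-th root
  of unity, so the geometric sum vanishes unless \<open>x = 1\<close>. That would require N to
  divide k - l, and |k - l| < N leaves only k = l.\<close>

lemma sum_cis_multiples:
  fixes k l N :: nat
  assumes "k < N" "l < N"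
  shows "(\<Sum>j<N. cis (2 * pi * real j / real N) ^ k * cnj (cis (2 * pi * real j / real N)) ^ l)
           = (if k = l then of_nat N else 0)"
proof -
  define x where "x = cis (2 * pi * (real k - real l) / real N)"
  have N: "real N \<noteq> 0"
    using assms by simp
  have "cis (2 * pi * real j / real N) ^ k * cnj (cis (2 * pi * real j / real N)) ^ l = x ^ j" for j
    by (simp add: x_def Complex.DeMoivre cis_cnj cis_mult algebra_simps diff_divide_distrib)
  hence eq: "(\<Sum>j<N. cis (2 * pi * real j / real N) ^ k * cnj (cis (2 * pi * real j / real N)) ^ l)
               = (\<Sum>j<N. x ^ j)"
    by simp
  show ?thesis
  proof (cases "k = l")
    case True
    thus ?thesis
      unfolding eq by (simp add: x_def)
  next
    case False
    have "x ^ N = cis (2 * pi * real_of_int (int k - int l))"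
      unfolding x_def Complex.DeMoivre using N by simp
    also have "\<dots> = 1"
      by (rule cis_multiple_2pi) auto
    finally have xN: "x ^ N = 1" .
    have "x \<noteq> 1"
    proof
      assume "x = 1"
      hence "cos (2 * pi * (real k - real l) / real N) = 1"
        by (simp add: x_def complex_eq_iff)
      then obtain m :: int where "2 * pi * (real k - real l) / real N = of_int m * 2 * pi"
        using cos_one_2pi_int by auto
      hence "2 * pi * ((real k - real l) / real N) = 2 * pi * of_int m"
        by simp
      hence "(real k - real l) / real N = of_int m"
        unfolding mult_cancel_left by simp
      hence "real k - real l = of_int m * real N"
        using N by (simp add: field_simps)
      hence "of_int (int k - int l) = (of_int (m * int N) :: real)"
        by simp
      hence m: "int k - int l = m * int N"
        using of_int_eq_iff by blast
      with False have "m \<noteq> 0"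
        by auto
      hence "int N \<le> \<bar>m\<bar> * int N"
        using mult_right_mono[of 1 "\<bar>m\<bar>" "int N"] by simp
      also have "\<dots> = \<bar>int k - int l\<bar>"
        using m by (simp add: abs_mult)
      also have "\<dots> < int N"
        using assms by auto
      finally show False
        by simp
    qed
    thus ?thesis
      unfolding eq using False xN by (simp add: sum_gp_strict)
  qed
qed

text \<open>Averaging over N equally spaced points replaces the integral over the circle. It is
  exact because only exponents below N occur, so no two of them are congruent modulo N.\<close>

lemma discrete_parseval:
  fixes c :: "nat \<Rightarrow> complex"
  shows "(\<Sum>j<N. (cmod (\<Sum>k<N. c k * cis (2 * pi * real j / real N) ^ k))\<^sup>2)
           = real N * (\<Sum>k<N. (cmod (c k))\<^sup>2)"
proof -
  define w where "w = (\<lambda>j. cis (2 * pi * real j / real N))"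
  have "complex_of_real (\<Sum>j<N. (cmod (\<Sum>k<N. c k * w j ^ k))\<^sup>2)
      = (\<Sum>j<N. \<Sum>k<N. \<Sum>l<N. c k * cnj (c l) * (w j ^ k * cnj (w j) ^ l))"
    by (simp add: complex_norm_square sum_product algebra_simps del: of_real_power)
  also have "\<dots> = (\<Sum>k<N. \<Sum>j<N. \<Sum>l<N. c k * cnj (c l) * (w j ^ k * cnj (w j) ^ l))"
    by (rule sum.swap)
  also have "\<dots> = (\<Sum>k<N. \<Sum>l<N. \<Sum>j<N. c k * cnj (c l) * (w j ^ k * cnj (w j) ^ l))"
    by (intro sum.cong refl sum.swap)
  also have "\<dots> = (\<Sum>k<N. \<Sum>l<N. c k * cnj (c l) * (if k = l then of_nat N else 0))"
    by (intro sum.cong refl) (simp add: sum_cis_multiples w_def flip: sum_distrib_left)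
  also have "\<dots> = (\<Sum>k<N. c k * cnj (c k) * of_nat N)"
    by (intro sum.cong refl) (simp add: if_distrib sum.delta cong: if_cong)
  also have "\<dots> = complex_of_real (real N * (\<Sum>k<N. (cmod (c k))\<^sup>2))"
    by (simp add: complex_norm_square sum_distrib_left mult_ac del: of_real_power)
  finally show ?thesis
    unfolding w_def of_real_eq_iff .
qed

text \<open>On a circle of radius r < 1 the Taylor polynomials converge uniformly to f, so those of
  large degree are bounded by M + e there. Discrete Parseval turns this bound into one for the
  coefficients weighted by r^k. Then e tends to 0, and afterwards r tends to 1.\<close>

lemma sum_norm_coeff_square_le:
  fixes F :: "complex fps"
  assumes exp: "f has_fps_expansion F" and hol: "f holomorphic_on ball 0 1"
    and bound: "\<And>z. norm z < 1 \<Longrightarrow> norm (f z) \<le> M"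
  shows "(\<Sum>k<n. (cmod (fps_nth F k))\<^sup>2) \<le> M\<^sup>2"
proof -
  have M: "M \<ge> 0"
    using bound[of 0] norm_ge_zero[of "f 0"] by (simp del: norm_ge_zero)
  have hol': "f holomorphic_on eball 0 1"
    using hol by (simp add: one_ereal_def)
  have sums: "(\<lambda>k. fps_nth F k * z ^ k) sums f z" if "norm z < 1" for z
    using has_fps_expansion_imp_sums_complex[OF exp hol'] that by simp
  have radius: "conv_radius (fps_nth F) \<ge> 1"
    using holomorphic_on_imp_fps_conv_radius_ge[OF exp hol'] by (simp add: fps_conv_radius_def)
  have circle: "(\<Sum>k<n. (cmod (fps_nth F k) * r ^ k)\<^sup>2) \<le> M\<^sup>2" if r: "0 < r" "r < 1" for r
  proof -
    \<comment> \<open>Taking the root makes the error e additive, which is the form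
      \<open>field_le_epsilon\<close> removes.\<close>
    have "sqrt (\<Sum>k<n. (cmod (fps_nth F k) * r ^ k)\<^sup>2) \<le> M + e" if e: "e > 0" for e
    proof -
      have "ereal r < conv_radius (fps_nth F)"
        using r radius by (metis ereal_less(3) order_less_le_trans)
      hence "uniform_limit (cball 0 r) (\<lambda>N z. \<Sum>k<N. fps_nth F k * z ^ k)
               (\<lambda>z. \<Sum>k. fps_nth F k * z ^ k) sequentially"
        using powser_uniform_limit[of r "fps_nth F" 0] by simp
      hence "\<forall>\<^sub>F N in sequentially. \<forall>z\<in>cball 0 r.
               dist (\<Sum>k<N. fps_nth F k * z ^ k) (\<Sum>k. fps_nth F k * z ^ k) < e"
        using e by (rule uniform_limitD)
      \<comment> \<open>\<open>N \<ge> Suc n\<close> serves twice: N > 0 lets the factor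
        \<open>real N\<close> be cancelled, and n \<le> N lets the sum be truncated to n
        terms.\<close>
      hence "\<forall>\<^sub>F N in sequentially. N \<ge> Suc n \<and> (\<forall>z\<in>cball 0 r.
               dist (\<Sum>k<N. fps_nth F k * z ^ k) (\<Sum>k. fps_nth F k * z ^ k) < e)"
        by (intro eventually_conj eventually_ge_at_top)
      then obtain N where N: "N \<ge> Suc n" and dist: "\<And>z. norm z \<le> r \<Longrightarrow>
               dist (\<Sum>k<N. fps_nth F k * z ^ k) (\<Sum>k. fps_nth F k * z ^ k) < e"
        by (auto simp: eventually_at_top_linorder)
      have partial: "norm (\<Sum>k<N. fps_nth F k * z ^ k) \<le> M + e" if z: "norm z \<le> r" for z
      proof -
        have "(\<Sum>k. fps_nth F k * z ^ k) = f z"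
          using sums[of z] z r by (simp add: sums_iff)
        hence "dist (\<Sum>k<N. fps_nth F k * z ^ k) (f z) < e"
          using dist[OF z] by simp
        thus ?thesis
          using bound[of z] z r norm_triangle_sub[of "\<Sum>k<N. fps_nth F k * z ^ k" "f z"]
          by (simp add: dist_norm)
      qed
      define w where "w = (\<lambda>j. cis (2 * pi * real j / real N))"
      have "real N * (\<Sum>k<N. (cmod (fps_nth F k * of_real r ^ k))\<^sup>2)
              = (\<Sum>j<N. (cmod (\<Sum>k<N. fps_nth F k * of_real r ^ k * w j ^ k))\<^sup>2)"
        unfolding w_def by (rule discrete_parseval[symmetric])
      also have "\<dots> = (\<Sum>j<N. (cmod (\<Sum>k<N. fps_nth F k * (of_real r * w j) ^ k))\<^sup>2)"
        by (simp add: power_mult_distrib mult.assoc)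
      also have "\<dots> \<le> (\<Sum>j<N. (M + e)\<^sup>2)"
        using r by (intro sum_mono power_mono partial) (auto simp: w_def norm_mult)
      finally have "(\<Sum>k<N. (cmod (fps_nth F k * of_real r ^ k))\<^sup>2) \<le> (M + e)\<^sup>2"
        using N by simp
      moreover have "(\<Sum>k<n. (cmod (fps_nth F k) * r ^ k)\<^sup>2)
                       \<le> (\<Sum>k<N. (cmod (fps_nth F k) * r ^ k)\<^sup>2)"
        using N by (intro sum_mono2) auto
      ultimately have "(\<Sum>k<n. (cmod (fps_nth F k) * r ^ k)\<^sup>2) \<le> (M + e)\<^sup>2"
        using r by (simp add: norm_mult norm_power)
      thus ?thesis
        using M e by (intro real_le_lsqrt) auto
    qed
    hence "sqrt (\<Sum>k<n. (cmod (fps_nth F k) * r ^ k)\<^sup>2) \<le> M"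
      by (rule field_le_epsilon)
    thus ?thesis
      by (simp add: sqrt_le_D)
  qed
  \<comment> \<open>With n fixed the sum is a polynomial in r, so the bound passes to the limit r =
    1 without any control of f on the unit circle.\<close>
  have "((\<lambda>r. \<Sum>k<n. (cmod (fps_nth F k) * r ^ k)\<^sup>2) \<longlongrightarrow> (\<Sum>k<n. (cmod (fps_nth F k) * 1 ^ k)\<^sup>2))
          (at_left (1::real))"
    by (intro tendsto_intros)
  moreover have "\<forall>\<^sub>F r in at_left (1::real). (\<Sum>k<n. (cmod (fps_nth F k) * r ^ k)\<^sup>2) \<le> M\<^sup>2"
    using eventually_at_left_real[OF zero_less_one] by eventually_elim (use circle in auto)
  ultimately show ?thesis
    using tendsto_upperbound[where F = "at_left (1::real)"] by fastforce
qed

section \<open>The function U_f and the coefficient inequality\<close>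

text \<open>The quotient rule for f = w / q gives f' = (q - w q') / q^2, and the factor (w / f)^2 =
  q^2 cancels the denominator. What remains is continuous even at z = 0 or at a zero of q, so it is
  the value that \<open>remove_sings\<close> fills in.\<close>

lemma U_op_eqI:
  assumes q: "q analytic_on {z}" and nz: "\<forall>\<^sub>F w in at z. q w \<noteq> 0"
    and f: "\<forall>\<^sub>F w in at z. f w = w / q w"
  shows "U_op f z = q z - z * deriv q z"
proof -
  obtain S where S: "open S" "z \<in> S" "q holomorphic_on S"
    using q unfolding analytic_at by blast
  have "\<forall>\<^sub>F w in at z. w \<noteq> 0 \<and> w \<in> S \<and> q w \<noteq> 0 \<and> f w = w / q w"
    using nz f eventually_at_in_open'[OF S(1,2)] eventually_neq_at_within[of 0 z UNIV]
    by eventually_elim auto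
  then obtain T where T: "open T" "z \<in> T"
    "\<And>w. w \<in> T - {z} \<Longrightarrow> w \<noteq> 0 \<and> w \<in> S \<and> q w \<noteq> 0 \<and> f w = w / q w"
    unfolding eventually_at_topological by blast
  have "\<forall>\<^sub>F w in at z. q w - w * deriv q w = (w / f w)\<^sup>2 * deriv f w"
    using eventually_at_in_open[OF T(1,2)]
  proof eventually_elim
    case (elim w)
    note w = T(3)[OF elim]
    have "(q has_field_derivative deriv q w) (at w)"
      using S w by (intro holomorphic_derivI) auto
    hence "((\<lambda>u. u / q u) has_field_derivative (q w - w * deriv q w) / (q w)\<^sup>2) (at w)"
      using w by (auto intro!: derivative_eq_intros simp: power2_eq_square)
    \<comment> \<open>Differentiating f at w needs the formula in a full neighbourhood of w;
      \<open>T - {z}\<close> is one because it is open.\<close>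
    moreover have "\<forall>\<^sub>F u in nhds w. u / q u = f u"
      using eventually_nhds_in_open[of "T - {z}" w] T elim
      by (auto elim!: eventually_mono simp: open_delete)
    ultimately have "(f has_field_derivative (q w - w * deriv q w) / (q w)\<^sup>2) (at w)"
      using has_field_derivative_cong_eventually[of "\<lambda>u. u / q u" f w UNIV] w
      by (simp add: eventually_at_filter eventually_mono)
    thus ?case
      using w by (simp add: DERIV_imp_deriv)
  qed
  moreover have "(\<lambda>w. q w - w * deriv q w) \<midarrow>z\<rightarrow> q z - z * deriv q z"
    by (intro isContD analytic_at_imp_isCont analytic_intros q)
  ultimately have "(\<lambda>w. (w / f w)\<^sup>2 * deriv f w) \<midarrow>z\<rightarrow> q z - z * deriv q z"
    by (rule Lim_transform_eventually[rotated])
  thus ?thesis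
    unfolding U_op_def by (rule remove_sings_eqI)
qed


text \<open>Boundedness rules out poles: near a pole the norm would exceed
  \<open>lam + norm mu\<close>. A nicely meromorphic function without poles is analytic.\<close>

lemma U_op_holomorphic:
  assumes "f \<in> U_class lam mu"
  shows "U_op f holomorphic_on ball 0 1"
proof -
  have f: "f meromorphic_on ball 0 1"
    and bound: "\<And>z. z \<in> ball 0 1 \<Longrightarrow> cmod (U_op f z - mu) < lam"
    using assms by (auto simp: U_class_def nicely_meromorphic_on_def)
  have nice: "U_op f nicely_meromorphic_on ball 0 1"
    unfolding U_op_def
    by (intro remove_sings_nicely_meromorphic meromorphic_intros f)
  have "U_op f analytic_on {z}" if z: "z \<in> ball 0 1" for z
  proof (rule nicely_meromorphic_on_imp_analytic_at[OF nice z])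
    show "\<not> is_pole (U_op f) z"
    proof
      assume "is_pole (U_op f) z"
      hence "\<forall>\<^sub>F w in at z. norm (U_op f w) \<ge> lam + norm mu"
        unfolding is_pole_def by (simp add: filterlim_at_infinity_imp_norm_at_top[unfolded filterlim_at_top])
      moreover have "\<forall>\<^sub>F w in at z. w \<in> ball 0 1"
        using z by (intro eventually_at_in_open') auto
      ultimately have "\<forall>\<^sub>F w in at z. False"
      proof eventually_elim
        case (elim w)
        thus ?case
          using bound[of w] norm_triangle_sub[of "U_op f w" mu] by linarith
      qed
      thus False
        by simp
    qed
  qed
  thus ?thesis
    using analytic_imp_holomorphic analytic_on_analytic_at by blast
qed

text \<open>With q = z / f, near 0 the function U_f equals q - z q', which has k-th coefficient (1 -
  k) b_k for k \<ge> 1. The constant term of \<open>F\<close> is set to 1 by hand because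
  \<open>b 0\<close> is arbitrary.\<close>

lemma U_op_has_fps_expansion:
  assumes f: "f \<in> U_class lam mu" and b: "id_quot_expansion f b"
  defines "F \<equiv> Abs_fps (\<lambda>k. if k = 0 then 1 else b k)"
  shows "U_op f has_fps_expansion F - fps_X * fps_deriv F"
proof -
  have sums: "\<forall>\<^sub>F z in nhds 0. (\<lambda>k. fps_nth F k * z ^ k) sums id_quot f z"
    using b unfolding id_quot_expansion_def
  proof eventually_elim
    case (elim z)
    have "(\<lambda>k. fps_nth F (Suc k) * z ^ Suc k) sums (id_quot f z - 1)"
      using elim by (simp add: F_def)
    from sums_Suc[OF this] show ?case
      by (simp add: F_def)
  qed
  hence q: "id_quot f has_fps_expansion F"
    by (rule has_fps_expansionI)
  hence ana: "id_quot f analytic_on {0}"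
    by (rule has_fps_expansion_imp_analytic_0)
  have q0: "id_quot f 0 = 1"
    using has_fps_expansion_imp_0_eq_fps_nth_0[OF q] by (simp add: F_def)
  have "f meromorphic_on {0}"
    using f by (auto simp: U_class_def intro: analytic_on_imp_meromorphic_on)
  hence "(\<lambda>z. z / f z) meromorphic_on {0}"
    by (intro meromorphic_intros) (auto intro!: analytic_on_imp_meromorphic_on)
  hence "isolated_singularity_at (\<lambda>z. z / f z) 0"
    by (simp add: meromorphic_on_isolated_singularity)
  hence quot: "\<forall>\<^sub>F z in at 0. id_quot f z = z / f z"
    unfolding id_quot_def by (rule eventually_remove_sings_eq_at)
  have nz: "\<forall>\<^sub>F z in at 0. id_quot f z \<noteq> 0"
    using analytic_at_imp_isCont[OF ana] q0
    by (metis isContD tendsto_imp_eventually_ne zero_neq_one)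
  \<comment> \<open>Solving q = z / f for f only needs z \<noteq> 0: if f z = 0, both sides are 0 by
    the convention x / 0 = 0.\<close>
  have inv: "\<forall>\<^sub>F z in at 0. f z = z / id_quot f z"
    using quot eventually_neq_at_within[of 0 0 UNIV] by eventually_elim auto
  obtain S where S: "open S" "0 \<in> S" "id_quot f holomorphic_on S"
    using ana unfolding analytic_at by blast
  have "\<forall>\<^sub>F z in at 0. id_quot f z \<noteq> 0 \<and> f z = z / id_quot f z"
    using nz inv by eventually_elim auto
  \<comment> \<open>\<open>U_op_eqI\<close> is applied at every point near 0, not only at 0, so the
    relation must hold around each of these points.\<close>
  hence "\<forall>\<^sub>F z in nhds 0. \<forall>\<^sub>F w in nhds z. w \<noteq> 0 \<longrightarrow> id_quot f w \<noteq> 0 \<and> f w = w / id_quot f w"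
    by (simp add: eventually_at_filter eventually_eventually)
  hence local: "\<forall>\<^sub>F z in nhds 0. id_quot f analytic_on {z} \<and>
                 (\<forall>\<^sub>F w in at z. id_quot f w \<noteq> 0 \<and> f w = w / id_quot f w)"
    using eventually_nhds_in_open[OF S(1,2)]
  proof eventually_elim
    case (elim z)
    have "\<forall>\<^sub>F w in at z. w \<noteq> 0 \<longrightarrow> id_quot f w \<noteq> 0 \<and> f w = w / id_quot f w"
      using elim(1) by (auto simp: eventually_at_filter elim: eventually_mono)
    hence "\<forall>\<^sub>F w in at z. id_quot f w \<noteq> 0 \<and> f w = w / id_quot f w"
      using eventually_neq_at_within[of 0 z UNIV] by eventually_elim auto
    thus ?case
      using S elim(2) by (auto simp: analytic_at)
  qed
  have "\<forall>\<^sub>F z in nhds 0. id_quot f z - z * deriv (id_quot f) z = U_op f z"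
    using local by eventually_elim (auto simp: U_op_eqI eventually_conj_iff)
  moreover have "(\<lambda>z. id_quot f z - z * deriv (id_quot f) z) has_fps_expansion F - fps_X * fps_deriv F"
    by (intro fps_expansion_intros q)
  ultimately show ?thesis
    by (simp add: has_fps_expansion_cong)
qed

text \<open>Gutzmer's inequality is applied to U_f - mu with bound \<open>lam\<close>; the linear
  coefficient is 0, so b_1 drops out. Arbitrary finite index sets give both summability and the
  bound on the infinite sum.\<close>

lemma U_class_coeff_sum_le:
  assumes f: "f \<in> U_class lam mu" and b: "id_quot_expansion f b"
    and A: "finite A" "A \<subseteq> {2..}"
  shows "(\<Sum>k\<in>A. (cmod (b k))\<^sup>2 * (real k - 1)\<^sup>2) \<le> lam\<^sup>2 - (cmod (1 - mu))\<^sup>2"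
proof -
  define F where "F = Abs_fps (\<lambda>k. if k = 0 then 1 else b k)"
  define G where "G = F - fps_X * fps_deriv F - fps_const mu"
  have G0: "fps_nth G 0 = 1 - mu"
    by (simp add: G_def F_def)
  have G: "cmod (fps_nth G k) = cmod (b k) * (real k - 1)" if "k \<ge> 2" for k
  proof -
    have "fps_nth G k = - (b k * of_real (real k - 1))"
      using that by (cases k) (auto simp: G_def F_def algebra_simps)
    thus ?thesis
      using that by (simp only: norm_minus_cancel norm_mult norm_of_real)
  qed
  have exp: "(\<lambda>z. U_op f z - mu) has_fps_expansion G"
    unfolding G_def F_def by (intro fps_expansion_intros U_op_has_fps_expansion[OF f b])
  have hol: "(\<lambda>z. U_op f z - mu) holomorphic_on ball 0 1"
    by (intro holomorphic_intros U_op_holomorphic[OF f])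
  have bound: "cmod (U_op f z - mu) \<le> lam" if "norm z < 1" for z
    using f that by (auto simp: U_class_def less_imp_le)
  \<comment> \<open>Index 0, which is not in A, contributes the square of |1 - mu|.\<close>
  obtain n where n: "insert 0 A \<subseteq> {..<n}"
    using A finite_nat_bounded[of "insert 0 A"] by auto
  have "(cmod (1 - mu))\<^sup>2 + (\<Sum>k\<in>A. (cmod (b k))\<^sup>2 * (real k - 1)\<^sup>2)
          = (\<Sum>k\<in>insert 0 A. (cmod (fps_nth G k))\<^sup>2)"
    using A by (subst sum.insert) (auto simp: G0 G power_mult_distrib intro!: sum.cong)
  also have "\<dots> \<le> (\<Sum>k<n. (cmod (fps_nth G k))\<^sup>2)"
    using n by (intro sum_mono2) auto
  also have "\<dots> \<le> lam\<^sup>2"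
    by (rule sum_norm_coeff_square_le[OF exp hol bound])
  finally show ?thesis
    by simp
qed

section \<open>Functions z / B(z) for a power series B on the disc\<close>

text \<open>The value 1 at 0 shows that the function is not identically zero on the disc, so its
  zeros are isolated.\<close>

lemma eval_fps_nonzero_near:
  fixes B :: "complex fps"
  assumes "fps_conv_radius B \<ge> 1" "fps_nth B 0 = 1" "norm z < 1"
  shows "\<forall>\<^sub>F w in at z. eval_fps B w \<noteq> 0"
proof -
  have "eval_fps B holomorphic_on ball 0 1"
    using assms by (intro holomorphic_on_eval_fps ball_eball_mono) (simp add: one_ereal_def)
  hence "\<forall>\<^sub>F w in at z. eval_fps B w \<noteq> 0 \<and> w \<in> ball 0 1"
    using assms by (intro non_zero_neighbour_alt[where \<beta> = 0]) (auto simp: eval_fps_at_0)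
  thus ?thesis
    by (rule eventually_mono) simp
qed

lemma eval_fps_analytic_at:
  fixes B :: "complex fps"
  assumes "fps_conv_radius B \<ge> 1" "norm z < 1"
  shows "eval_fps B analytic_on {z}"
proof -
  have "eval_fps B holomorphic_on ball 0 1"
    using assms by (intro holomorphic_on_eval_fps ball_eball_mono) (simp add: one_ereal_def)
  thus ?thesis
    using assms(2) unfolding analytic_at by (intro exI[of _ "ball 0 1"]) auto
qed

lemma id_over_eval_fps_nicely_meromorphic:
  fixes B :: "complex fps"
  assumes "fps_conv_radius B \<ge> 1" "fps_nth B 0 = 1"
  shows "(\<lambda>z. z / eval_fps B z) nicely_meromorphic_on ball 0 1"
  unfolding nicely_meromorphic_on_def
proof (intro conjI ballI)
  have "eval_fps B analytic_on ball 0 1"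
    using eval_fps_analytic_at[OF assms(1)] by (subst analytic_on_analytic_at) auto
  thus "(\<lambda>z. z / eval_fps B z) meromorphic_on ball 0 1"
    by (intro meromorphic_on_divide analytic_on_imp_meromorphic_on analytic_on_ident)
next
  fix z :: complex
  assume "z \<in> ball 0 1"
  hence z: "norm z < 1"
    by simp
  have cont: "isCont (eval_fps B) z"
    using eval_fps_analytic_at[OF assms(1) z] by (rule analytic_at_imp_isCont)
  show "is_pole (\<lambda>z. z / eval_fps B z) z \<and> z / eval_fps B z = 0 \<or>
          (\<lambda>z. z / eval_fps B z) \<midarrow>z\<rightarrow> z / eval_fps B z"
  proof (cases "eval_fps B z = 0")
    \<comment> \<open>A zero of B lies away from 0 and so is a pole of z / B(z); division by zero
      yields exactly the value 0 prescribed at poles.\<close>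
    case True
    hence "z \<noteq> 0"
      using assms(2) by (auto simp: eval_fps_at_0)
    moreover have "filterlim (eval_fps B) (at 0) (at z)"
      using isContD[OF cont] eval_fps_nonzero_near[OF assms z] unfolding True
      by (rule filterlim_atI)
    ultimately have "is_pole (\<lambda>z. z / eval_fps B z) z"
      by (intro is_pole_divide continuous_ident)
    thus ?thesis
      using True by simp
  next
    case False
    thus ?thesis
      by (intro disjI2 tendsto_divide tendsto_ident_at isContD[OF cont])
  qed
qed

lemma id_over_eval_fps_DERIV_0:
  fixes B :: "complex fps"
  assumes "fps_conv_radius B \<ge> 1" "fps_nth B 0 = 1"
  shows "((\<lambda>z. z / eval_fps B z) has_field_derivative 1) (at 0)"
proof -
  have "ereal (norm (0::complex)) < fps_conv_radius B"
    unfolding norm_zero zero_ereal_def[symmetric]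
    using assms(1) by (rule order_less_le_trans[rotated]) simp
  hence "(eval_fps B has_field_derivative eval_fps (fps_deriv B) 0) (at 0)"
    by (rule has_field_derivative_eval_fps)
  from DERIV_divide[OF DERIV_ident this] show ?thesis
    using assms(2) by (simp add: eval_fps_at_0)
qed

lemma id_over_eval_fps_expansion:
  fixes B :: "complex fps"
  assumes "fps_conv_radius B \<ge> 1" "fps_nth B 0 = 1"
  shows "id_quot_expansion (\<lambda>z. z / eval_fps B z) (fps_nth B)"
  unfolding id_quot_expansion_def
proof -
  have "(\<lambda>k. fps_nth B (Suc k) * z ^ Suc k) sums (id_quot (\<lambda>z. z / eval_fps B z) z - 1)"
    if z: "norm z < 1" for z
  proof -
    \<comment> \<open>Dividing twice fails to return B at w = 0, where it gives 0 instead of 1. The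
      limit restores B there.\<close>
    have "\<forall>\<^sub>F w in at z. eval_fps B w = w / (w / eval_fps B w)"
      using eventually_neq_at_within[of 0 z UNIV] eval_fps_nonzero_near[OF assms z]
      by eventually_elim auto
    moreover have "eval_fps B \<midarrow>z\<rightarrow> eval_fps B z"
      by (intro isContD analytic_at_imp_isCont eval_fps_analytic_at assms z)
    ultimately have "(\<lambda>w. w / (w / eval_fps B w)) \<midarrow>z\<rightarrow> eval_fps B z"
      by (rule Lim_transform_eventually[rotated])
    hence "id_quot (\<lambda>z. z / eval_fps B z) z = eval_fps B z"
      unfolding id_quot_def by (rule remove_sings_eqI)
    moreover have "ereal (norm z) < fps_conv_radius B"
      using z assms(1) by (metis ereal_less(3) order_less_le_trans)
    hence "(\<lambda>k. fps_nth B k * z ^ k) sums eval_fps B z"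
      by (rule sums_eval_fps)
    ultimately show ?thesis
      using assms(2) by (subst sums_Suc_iff) simp
  qed
  moreover have "\<forall>\<^sub>F z in nhds (0::complex). z \<in> ball 0 1"
    by (intro eventually_nhds_in_open) auto
  ultimately show "\<forall>\<^sub>F z in nhds 0.
      (\<lambda>k. fps_nth B (Suc k) * z ^ Suc k) sums (id_quot (\<lambda>z. z / eval_fps B z) z - 1)"
    by (auto elim!: eventually_mono)
qed

lemma U_op_id_over_eval_fps:
  fixes B :: "complex fps"
  assumes "fps_conv_radius B \<ge> 1" "fps_nth B 0 = 1" and z: "norm z < 1"
  shows "U_op (\<lambda>z. z / eval_fps B z) z = eval_fps (B - fps_X * fps_deriv B) z"
proof -
  have r: "ereal (norm z) < fps_conv_radius B"
    using z assms(1) by (metis ereal_less(3) order_less_le_trans)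
  hence r': "ereal (norm z) < fps_conv_radius (fps_deriv B)"
    using fps_conv_radius_deriv[of B] by (rule order_less_le_trans)
  have "min (fps_conv_radius (fps_X :: complex fps)) (fps_conv_radius (fps_deriv B))
          \<le> fps_conv_radius (fps_X * fps_deriv B)"
    by (rule fps_conv_radius_mult)
  hence r'': "ereal (norm z) < fps_conv_radius (fps_X * fps_deriv B)"
    using r' by (simp add: min_def split: if_splits)
  have "U_op (\<lambda>z. z / eval_fps B z) z = eval_fps B z - z * deriv (eval_fps B) z"
    by (intro U_op_eqI eval_fps_analytic_at eval_fps_nonzero_near assms) auto
  also have "deriv (eval_fps B) z = eval_fps (fps_deriv B) z"
    by (intro DERIV_imp_deriv has_field_derivative_eval_fps r)
  finally show ?thesis
    using r r' r'' by (simp add: eval_fps_diff eval_fps_mult)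
qed

section \<open>The extremal function\<close>

text \<open>With 1 - mu = lam a, these are the coefficients of the intended U_f = mu + lam (z^2 + a)
  / (1 + cnj a z^2), not of z / f. Splitting off the constant mu + lam a = 1 leaves lam (1 - |a|^2)
  z^2 / (1 + cnj a z^2), a geometric series in z^2.\<close>

definition extremal_coeff :: "real \<Rightarrow> complex \<Rightarrow> nat \<Rightarrow> complex" where
  "extremal_coeff lam a k =
     (if k = 0 then 1
      else if even k then of_real (lam * (1 - (cmod a)\<^sup>2)) * (- cnj a) ^ (k div 2 - 1) else 0)"

lemma extremal_coeff_even:
  "extremal_coeff lam a (2 * j + 2) = of_real (lam * (1 - (cmod a)\<^sup>2)) * (- cnj a) ^ j"
  by (simp add: extremal_coeff_def)

lemma extremal_coeff_eq_0:
  assumes "k \<noteq> 0" "k \<notin> range (\<lambda>j. 2 * j + 2)"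
  shows "extremal_coeff lam a k = 0"
proof -
  have "odd k"
  proof
    assume "even k"
    with assms(1) have "k = 2 * (k div 2 - 1) + 2"
      by presburger
    with assms(2) show False
      by blast
  qed
  thus ?thesis
    using assms(1) by (simp add: extremal_coeff_def)
qed

lemma norm_extremal_coeff_even_square:
  "(cmod (extremal_coeff lam a (2 * j + 2)))\<^sup>2 = (lam * (1 - (cmod a)\<^sup>2))\<^sup>2 * ((cmod a)\<^sup>2) ^ j"
  unfolding extremal_coeff_even norm_mult norm_of_real norm_power
  by (simp add: power_mult_distrib power_even_abs mult.commute flip: power_mult)

text \<open>\<open>Moebius_function 0 (- a)\<close> sends w to (w + a) / (1 + cnj a w). Writing the
  sum through it makes the standard bound by 1 on the disc available.\<close>

lemma extremal_coeff_sums: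
  assumes a: "cmod a < 1" and mu: "1 - mu = of_real lam * a" and z: "norm z < 1"
  shows "(\<lambda>k. extremal_coeff lam a k * z ^ k) sums
           (mu + of_real lam * Moebius_function 0 (- a) (z\<^sup>2))"
proof -
  define c where "c = complex_of_real (lam * (1 - (cmod a)\<^sup>2))"
  define x where "x = - cnj a * z\<^sup>2"
  have "cmod a * (cmod z)\<^sup>2 \<le> cmod a"
    using z by (simp add: mult_left_le power_le_one)
  hence x: "norm x < 1"
    using a by (simp add: x_def norm_mult norm_power)
  have "1 + cnj a * z\<^sup>2 = 1 - x"
    by (simp add: x_def)
  hence nz: "1 + cnj a * z\<^sup>2 \<noteq> 0"
    using x by auto
  have "(\<lambda>j. c * z\<^sup>2 * x ^ j) sums (c * z\<^sup>2 * (1 / (1 - x)))"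
    by (intro sums_mult geometric_sums x)
  also have "(\<lambda>j. c * z\<^sup>2 * x ^ j) = (\<lambda>j. extremal_coeff lam a (2 * j + 2) * z ^ (2 * j + 2))"
  proof
    fix j
    have "x ^ j = (- cnj a) ^ j * (z\<^sup>2) ^ j"
      unfolding x_def by (rule power_mult_distrib)
    moreover have "z ^ (2 * j + 2) = (z\<^sup>2) ^ j * z\<^sup>2"
      by (simp only: power_add power_mult)
    ultimately show "c * z\<^sup>2 * x ^ j = extremal_coeff lam a (2 * j + 2) * z ^ (2 * j + 2)"
      unfolding extremal_coeff_even c_def by (simp only: mult_ac)
  qed
  \<comment> \<open>Index 0 is outside the range of \<open>2 * j + 2\<close> but carries the
    coefficient 1, so it is masked for the reindexing and added back afterwards.\<close>
  finally have "(\<lambda>k. if k = 0 then 0 else extremal_coeff lam a k * z ^ k) sums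
                   (c * z\<^sup>2 * (1 / (1 - x)))"
    using sums_mono_reindex[of "\<lambda>j::nat. 2 * j + 2"
        "\<lambda>k. if k = 0 then 0 else extremal_coeff lam a k * z ^ k" "c * z\<^sup>2 * (1 / (1 - x))"]
    by (simp add: strict_mono_def extremal_coeff_eq_0 del: mult_Suc_right)
  from sums_add[OF sums_single[of 0 "\<lambda>_. 1 :: complex"] this]
  have "(\<lambda>k. extremal_coeff lam a k * z ^ k) sums (1 + c * z\<^sup>2 * (1 / (1 - x)))"
    by (rule sums_cong[THEN iffD1, rotated]) (simp add: extremal_coeff_def)
  also have "1 + c * z\<^sup>2 * (1 / (1 - x)) = mu + of_real lam * Moebius_function 0 (- a) (z\<^sup>2)"
  proof -
    have mu': "mu = 1 - of_real lam * a"
      using mu by (simp add: algebra_simps)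
    have c: "c = of_real lam * (1 - a * cnj a)"
      unfolding c_def by (simp add: complex_norm_square[symmetric])
    show ?thesis
      using nz by (simp add: c mu' x_def Moebius_function_def field_simps)
  qed
  finally show ?thesis .
qed

text \<open>Along the exponents 2j + 2 the squares form a geometric series of ratio |a|^2; summing
  it cancels one of the two factors 1 - |a|^2.\<close>

lemma extremal_coeff_square_has_sum:
  assumes a: "cmod a < 1"
  shows "((\<lambda>k. (cmod (extremal_coeff lam a k))\<^sup>2) has_sum lam\<^sup>2 * (1 - (cmod a)\<^sup>2)) {2..}"
proof -
  have a2: "(cmod a)\<^sup>2 < 1"
    using a by (simp add: abs_square_less_1)
  have "(\<lambda>j. (lam * (1 - (cmod a)\<^sup>2))\<^sup>2 * ((cmod a)\<^sup>2) ^ j) sums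
          ((lam * (1 - (cmod a)\<^sup>2))\<^sup>2 * (1 / (1 - (cmod a)\<^sup>2)))"
    using a2 by (intro sums_mult geometric_sums) simp
  hence "((\<lambda>j. (lam * (1 - (cmod a)\<^sup>2))\<^sup>2 * ((cmod a)\<^sup>2) ^ j) has_sum
          ((lam * (1 - (cmod a)\<^sup>2))\<^sup>2 * (1 / (1 - (cmod a)\<^sup>2)))) UNIV"
    by (rule sums_nonneg_imp_has_sum) simp
  also have "(lam * (1 - (cmod a)\<^sup>2))\<^sup>2 * (1 / (1 - (cmod a)\<^sup>2)) = lam\<^sup>2 * (1 - (cmod a)\<^sup>2)"
    using a2 by (simp add: power2_eq_square)
  also have "(\<lambda>j. (lam * (1 - (cmod a)\<^sup>2))\<^sup>2 * ((cmod a)\<^sup>2) ^ j)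
               = (\<lambda>k. (cmod (extremal_coeff lam a k))\<^sup>2) \<circ> (\<lambda>j. 2 * j + 2)"
    by (simp only: fun_eq_iff o_apply norm_extremal_coeff_even_square) simp
  finally have "((\<lambda>k. (cmod (extremal_coeff lam a k))\<^sup>2) has_sum lam\<^sup>2 * (1 - (cmod a)\<^sup>2))
                  (range (\<lambda>j. 2 * j + 2))"
    by (subst has_sum_reindex) (simp_all add: inj_on_def o_def)
  also have "?this \<longleftrightarrow> ?thesis"
    by (rule has_sum_cong_neutral) (auto intro!: extremal_coeff_eq_0)
  finally show ?thesis .
qed

text \<open>The construction runs backwards from U_f: dividing its coefficients by 1 - k gives B,
  and f = z / B. Zeros of B in the disc are harmless, since they become poles of f.\<close>

lemma U_class_extremal:
  assumes lam: "lam > 0" and mu: "cmod (1 - mu) < lam"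
  obtains f b where "f \<in> U_class lam mu" "id_quot_expansion f b"
    "((\<lambda>k. (cmod (b k))\<^sup>2 * (real k - 1)\<^sup>2) has_sum lam\<^sup>2 * (1 - (cmod (1 - mu))\<^sup>2 / lam\<^sup>2)) {2..}"
proof
  define a where "a = (1 - mu) / of_real lam"
  have a: "cmod a < 1"
    using lam mu by (simp add: a_def norm_divide)
  have mu_a: "1 - mu = of_real lam * a"
    using lam by (simp add: a_def)
  define p where "p = extremal_coeff lam a"
  (* at k = 1 the quotient is the junk value 0 / 0 = 0, a legitimate choice of b_1 since p 1 = 0 *)
  define B where "B = Abs_fps (\<lambda>k. p k / (1 - of_nat k))"
  define f where "f = (\<lambda>z. z / eval_fps B z)"
  have p_sums: "(\<lambda>k. p k * z ^ k) sums (mu + of_real lam * Moebius_function 0 (- a) (z\<^sup>2))"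
    if "norm z < 1" for z
    unfolding p_def using extremal_coeff_sums a mu_a that by blast
  have radius_p: "conv_radius p \<ge> 1"
    using p_sums by (intro conv_radius_geI_ex') (auto simp: sums_iff one_ereal_def)
  have norm_B: "cmod (fps_nth B k) * \<bar>real k - 1\<bar> = cmod (p k)" for k
  proof (cases "k = 1")
    case False
    have "(1 - of_nat k :: complex) = of_real (1 - real k)"
      by simp
    hence "cmod (1 - of_nat k) = \<bar>real k - 1\<bar>"
      by (simp only: norm_of_real abs_minus_commute)
    thus ?thesis
      using False by (simp add: B_def norm_divide)
  qed (simp add: p_def extremal_coeff_def)
  \<comment> \<open>Since |1 - k| \<ge> 1 for k \<noteq> 1, the division does not shrink the disc of
    convergence.\<close>
  have "norm (fps_nth B k) \<le> norm (p k)" for k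
  proof (cases "k = 1")
    case False
    hence "\<bar>real k - 1\<bar> \<ge> 1"
      by (cases k) auto
    thus ?thesis
      using norm_B[of k] mult_left_mono[of 1 "\<bar>real k - 1\<bar>" "cmod (fps_nth B k)"] by simp
  qed (simp add: B_def)
  have B0: "fps_nth B 0 = 1"
    by (simp add: B_def p_def extremal_coeff_def)
  \<comment> \<open>At k = 1 the left side is 0 for any B, so \<open>p 1 = 0\<close> is essential;
    composing the Moebius map with z^2 ensures it.\<close>
  have B_p: "fps_nth (B - fps_X * fps_deriv B) k = p k" for k
  proof (cases "k = 1")
    case False
    hence "(1 - of_nat k :: complex) \<noteq> 0"
      by simp
    thus ?thesis
      by (cases k) (auto simp: B_def field_simps)
  qed (simp add: B_def p_def extremal_coeff_def)
  have radius: "fps_conv_radius B \<ge> 1"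
    unfolding fps_conv_radius_def
  proof (rule conv_radius_geI_ex')
    fix r :: real
    assume r: "0 < r" "ereal r < 1"
    have "ereal r < conv_radius p"
      using r(2) radius_p by (rule order_less_le_trans)
    hence "summable (\<lambda>k. norm (p k * of_real r ^ k))"
      by (intro abs_summable_in_conv_radius) (use r in simp)
    thus "summable (\<lambda>k. fps_nth B k * of_real r ^ k)"
      by (rule summable_comparison_test'[where N = 0])
         (auto simp: norm_mult intro!: mult_right_mono \<open>\<And>k. norm (fps_nth B k) \<le> norm (p k)\<close>)
  qed
  have U: "cmod (U_op f z - mu) < lam" if z: "norm z < 1" for z
  proof -
    have "U_op f z = (\<Sum>k. p k * z ^ k)"
      unfolding f_def U_op_id_over_eval_fps[OF radius B0 z] by (simp only: eval_fps_def B_p)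
    also have "\<dots> = mu + of_real lam * Moebius_function 0 (- a) (z\<^sup>2)"
      using p_sums[OF z] by (simp add: sums_iff)
    finally have "cmod (U_op f z - mu) = lam * cmod (Moebius_function 0 (- a) (z\<^sup>2))"
      using lam by (simp add: norm_mult)
    also have "\<dots> < lam"
      using Moebius_function_norm_lt_1[of "- a" "z\<^sup>2" 0] a z lam
      by (simp add: norm_power power_less_one_iff)
    finally show ?thesis .
  qed
  have "eval_fps B analytic_on {0}"
    by (intro eval_fps_analytic_at radius) auto
  hence "f analytic_on {0}"
    unfolding f_def by (intro analytic_on_divide analytic_on_ident) (auto simp: B0 eval_fps_at_0)
  moreover have "deriv f 0 = 1"
    unfolding f_def by (intro DERIV_imp_deriv id_over_eval_fps_DERIV_0 radius B0)
  ultimately show "f \<in> U_class lam mu"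
    using U id_over_eval_fps_nicely_meromorphic[OF radius B0] by (auto simp: U_class_def f_def)
  show "id_quot_expansion f (fps_nth B)"
    unfolding f_def by (rule id_over_eval_fps_expansion[OF radius B0])
  have "(cmod (fps_nth B k))\<^sup>2 * (real k - 1)\<^sup>2 = (cmod (p k))\<^sup>2" for k
    by (simp flip: norm_B add: power_mult_distrib)
  moreover have "(cmod (1 - mu))\<^sup>2 / lam\<^sup>2 = (cmod a)\<^sup>2"
    using lam by (simp add: a_def norm_divide power_divide)
  ultimately show "((\<lambda>k. (cmod (fps_nth B k))\<^sup>2 * (real k - 1)\<^sup>2) has_sum
      lam\<^sup>2 * (1 - (cmod (1 - mu))\<^sup>2 / lam\<^sup>2)) {2..}"
    using extremal_coeff_square_has_sum[OF a, of lam] by (simp add: p_def)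
qed

theorem theorem4:
  fixes lam :: real and mu :: complex
  assumes "lam > 0" and "cmod (1 - mu) < lam"
  shows "(\<forall>f\<in>U_class lam mu. \<forall>b. id_quot_expansion f b \<longrightarrow>
            (\<lambda>k. (cmod (b k))\<^sup>2 * (real k - 1)\<^sup>2) summable_on {2..} \<and>
            (\<Sum>\<^sub>\<infinity>k\<in>{2..}. (cmod (b k))\<^sup>2 * (real k - 1)\<^sup>2)
              \<le> lam\<^sup>2 * (1 - (cmod (1 - mu))\<^sup>2 / lam\<^sup>2)) \<and>
         (\<exists>f\<in>U_class lam mu. \<exists>b. id_quot_expansion f b \<and>
            ((\<lambda>k. (cmod (b k))\<^sup>2 * (real k - 1)\<^sup>2) has_sum
              lam\<^sup>2 * (1 - (cmod (1 - mu))\<^sup>2 / lam\<^sup>2)) {2..})"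
proof (intro conjI ballI allI impI)
  have eq: "lam\<^sup>2 * (1 - (cmod (1 - mu))\<^sup>2 / lam\<^sup>2) = lam\<^sup>2 - (cmod (1 - mu))\<^sup>2"
    using assms by (simp add: field_simps)
  fix f b
  assume f: "f \<in> U_class lam mu" "id_quot_expansion f b"
  note bound = U_class_coeff_sum_le[OF f]
  show summable: "(\<lambda>k. (cmod (b k))\<^sup>2 * (real k - 1)\<^sup>2) summable_on {2..}"
    using bound by (intro nonneg_bdd_above_summable_on) (auto intro!: bdd_aboveI2)
  show "(\<Sum>\<^sub>\<infinity>k\<in>{2..}. (cmod (b k))\<^sup>2 * (real k - 1)\<^sup>2)
          \<le> lam\<^sup>2 * (1 - (cmod (1 - mu))\<^sup>2 / lam\<^sup>2)"
    unfolding eq using summable bound by (rule infsum_le_finite_sums)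
next
  show "\<exists>f\<in>U_class lam mu. \<exists>b. id_quot_expansion f b \<and>
          ((\<lambda>k. (cmod (b k))\<^sup>2 * (real k - 1)\<^sup>2) has_sum
            lam\<^sup>2 * (1 - (cmod (1 - mu))\<^sup>2 / lam\<^sup>2)) {2..}"
    using U_class_extremal[OF assms] by blast
qed

end
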